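(* Let $m\ge 2$, $\sigma_0\in\{-1,+1\}$, $\tau>0$, real numbers $\alpha_0,\alpha_1,\dots,\alpha_{m-1}$ with $\alpha_0\ge 0$, and a real $(m-1)\times(m-1)$ signed permutation matrix $P$ be given. Consider the system $$D\,\partial_t q + \hat A\,\partial_x q = \hat B q,\qquad \hat A=\begin{bmatrix} (\alpha_1,\dots,\alpha_{m-1}) & \sigma_0\\ P & 0_{(m-1)\times 1}\end{bmatrix},\quad \hat B=\begin{bmatrix} -\alpha_0 & 0_{1\times(m-1)}\\ 0_{(m-1)\times 1} & P\end{bmatrix},$$ $D=\operatorname{diag}(1,\tau,\dots,\tau)$, i.e. $\partial_t q_0+\sum_{j=1}^{m-1}\alpha_j\partial_x q_{j-1}+\sigma_0\partial_x q_{m-1}=-\alpha_0 q_0$ and $\tau\partial_t q_i+\sum_{j}p_{ij}\partial_x q_{j-1}=\sum_j p_{ij}q_j$ for $i=1,\dots,m-1$. Then: (i) (stability at $k=0$) every $\omega\in\mathbb{C}$ with $\det(-i\omega D-\hat B)=0$ satisfies $\operatorname{Im}\omega\le 0$ if and only if $P=R-E$ with $R$ real skew-symmetric and $E$ diagonal with diagonal entries in $\{0,1\}$; (ii) (stability as $|k|\to\infty$) if $P=P^*$, then all eigenvalues of $\hat A$ are real, for every choice of real $\alpha_1,\dots,\alpha_{m-1}$.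
   Context: A real signed permutation matrix is a square matrix with all entries in $\{-1,0,+1\}$ having exactly one nonzero entry in each row and in each column. The matrix $P^*=(p^*_{ij})_{i,j=1}^{m-1}$ is defined by $p^*_{ij}=0$ if $i+j\ne m$, $p^*_{ij}=\sigma_0(-1)^{j-1}$ if $i+j=m$ and $j\le m/2$, and $p^*_{ij}=\sigma_0(-1)^{m-j}$ if $i+j=m$ and $j>m/2$. The system is a first-order relaxation of $u_t+\sum_{j=0}^{m-1}\alpha_j\partial_x^j u+\sigma_0\partial_x^m u=0$ with $q_j\approx\partial_x^j u$. The dispersion relation of the system is $\det(-i\omega D+ik\hat A-\hat B)=0$ (ansatz $q=\hat q e^{i(kx-\omega t)}$); stability at a wavenumber means all its roots $\omega$ satisfy $\operatorname{Im}\omega\le0$, and in the limit $|k|\to\infty$ this reduces to the requirement that $\hat A$ have only real eigenvalues. *)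

theory Defs
  imports "Jordan_Normal_Form.Char_Poly"
begin

text \<open>Matrices are JNF matrices with 0-based indices. Paper index i (1..m-1) of P
  corresponds to JNF index i-1; the system unknowns q_0..q_{m-1} are indices 0..m-1.\<close>

definition signed_perm_mat :: "nat \<Rightarrow> real mat \<Rightarrow> bool" where
  "signed_perm_mat n P \<longleftrightarrow> P \<in> carrier_mat n n
     \<and> (\<forall>i<n. \<forall>j<n. P $$ (i,j) \<in> {-1, 0, 1})
     \<and> (\<forall>i<n. \<exists>!j. j < n \<and> P $$ (i,j) \<noteq> 0)
     \<and> (\<forall>j<n. \<exists>!i. i < n \<and> P $$ (i,j) \<noteq> 0)"

definition A_hat :: "nat \<Rightarrow> real \<Rightarrow> (nat \<Rightarrow> real) \<Rightarrow> real mat \<Rightarrow> real mat" where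
  "A_hat m \<sigma>0 \<alpha> P = mat m m (\<lambda>(i,j).
     if i = 0 then (if j = m - 1 then \<sigma>0 else \<alpha> (j+1))
     else (if j = m - 1 then 0 else P $$ (i-1, j)))"

definition B_hat :: "nat \<Rightarrow> (nat \<Rightarrow> real) \<Rightarrow> real mat \<Rightarrow> real mat" where
  "B_hat m \<alpha> P = mat m m (\<lambda>(i,j).
     if i = 0 \<and> j = 0 then - \<alpha> 0
     else if i = 0 \<or> j = 0 then 0
     else P $$ (i-1, j-1))"

definition D_mat :: "nat \<Rightarrow> real \<Rightarrow> real mat" where
  "D_mat m \<tau> = mat m m (\<lambda>(i,j). if i = j then (if i = 0 then 1 else \<tau>) else 0)"

definition P_star :: "nat \<Rightarrow> real \<Rightarrow> real mat" where
  "P_star m \<sigma>0 = mat (m-1) (m-1) (\<lambda>(i',j').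
     let i = i' + 1; j = j' + 1 in
     if i + j \<noteq> m then 0
     else if 2 * j \<le> m then \<sigma>0 * (-1) ^ (j - 1)
     else \<sigma>0 * (-1) ^ (m - j))"

definition cmat :: "real mat \<Rightarrow> complex mat" where
  "cmat A = map_mat complex_of_real A"

end

theory Submission
  imports Defs "HOL-Combinatorics.Cycles"
begin

text \<open>At wavenumber zero the dispersion relation factors, and stability says that every eigenvalue
  of \<open>P\<close> has nonpositive real part. If \<open>P = R - E\<close>, this holds because the quadratic form of \<open>P\<close>
  is \<open>x \<bullet> P x = - x \<bullet> E x \<le> 0\<close>. Conversely, a cycle of length \<open>l\<close> and sign \<open>s\<close> of the signed
  permutation \<open>P\<close> makes every solution of \<open>x ^ l = s\<close> an eigenvalue, and these solutions lie in the
  closed left half plane only if \<open>s = -1\<close> and \<open>l \<le> 2\<close>.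

  For \<open>P = P\<^sup>*\<close> the coefficient \<open>\<sigma>\<^sub>0\<close> in the first row completes the entries of \<open>P\<^sup>*\<close> to an
  antidiagonal whose square is the identity. The rows below the first then give \<open>z\<^sup>2 = 1\<close> for an
  eigenvalue \<open>z\<close>, unless the eigenvector is supported on its two outermost components, in which
  case \<open>z\<^sup>2 = \<alpha>\<^sub>1 z + 1\<close>.\<close>

section \<open>Spectra in the closed left half plane\<close>

definition spectrally_stable :: "complex mat \<Rightarrow> bool" where
  "spectrally_stable A \<longleftrightarrow> (\<forall>x. eigenvalue A x \<longrightarrow> Re x \<le> 0)"

definition skew_minus_projection :: "nat \<Rightarrow> real mat \<Rightarrow> bool" where
  "skew_minus_projection n P \<longleftrightarrow> (\<exists>R E. R \<in> carrier_mat n n \<and> E \<in> carrier_mat n n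
     \<and> transpose_mat R = - R
     \<and> (\<forall>i<n. \<forall>j<n. i \<noteq> j \<longrightarrow> E $$ (i,j) = 0)
     \<and> (\<forall>i<n. E $$ (i,i) \<in> {0, 1})
     \<and> P = R - E)"

lemma cmat_carrier [simp]: "cmat A \<in> carrier_mat nr nc \<longleftrightarrow> A \<in> carrier_mat nr nc"
  by (simp add: cmat_def)

lemma cmat_mult_vec_Re_Im:
  assumes "A \<in> carrier_mat nr nc" and "w \<in> carrier_vec nc"
  shows "map_vec Re (cmat A *\<^sub>v w) = A *\<^sub>v map_vec Re w"
    and "map_vec Im (cmat A *\<^sub>v w) = A *\<^sub>v map_vec Im w"
  using assms by (auto simp: cmat_def scalar_prod_def intro!: eq_vecI)

lemma scalar_prod_Re_Im_pos:
  assumes w: "w \<in> carrier_vec n" and "w \<noteq> 0\<^sub>v n"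
  shows "map_vec Re w \<bullet> map_vec Re w + map_vec Im w \<bullet> map_vec Im w > 0"
proof -
  obtain k where "k < n" "w $ k \<noteq> 0"
    using assms by (metis carrier_vecD eq_vecI index_zero_vec)
  have "map_vec Re w \<bullet> map_vec Re w + map_vec Im w \<bullet> map_vec Im w = (\<Sum>i<n. (cmod (w $ i))\<^sup>2)"
    using w by (simp add: scalar_prod_def atLeast0LessThan cmod_power2 sum.distrib
        flip: power2_eq_square)
  also have "\<dots> > 0"
    using \<open>k < n\<close> \<open>w $ k \<noteq> 0\<close> by (intro sum_pos2[of _ k]) auto
  finally show ?thesis .
qed

lemma spectrally_stable_if_quadratic_form_nonpos:
  assumes A: "A \<in> carrier_mat n n"
    and nonpos: "\<And>x. x \<in> carrier_vec n \<Longrightarrow> x \<bullet> (A *\<^sub>v x) \<le> 0"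
  shows "spectrally_stable (cmat A)"
  unfolding spectrally_stable_def
proof (intro allI impI)
  fix z assume "eigenvalue (cmat A) z"
  then obtain w where w: "w \<in> carrier_vec n" "w \<noteq> 0\<^sub>v n" and eig: "cmat A *\<^sub>v w = z \<cdot>\<^sub>v w"
    using A by (auto simp: eigenvalue_def eigenvector_def cmat_def)
  define u v where "u = map_vec Re w" and "v = map_vec Im w"
  have u: "u \<in> carrier_vec n" and v: "v \<in> carrier_vec n"
    using w by (simp_all add: u_def v_def)
  have Au: "A *\<^sub>v u = Re z \<cdot>\<^sub>v u - Im z \<cdot>\<^sub>v v"
    unfolding u_def cmat_mult_vec_Re_Im(1)[OF A w(1), symmetric] eig
    by (rule eq_vecI) (use w in \<open>auto simp: v_def\<close>)
  have Av: "A *\<^sub>v v = Im z \<cdot>\<^sub>v u + Re z \<cdot>\<^sub>v v"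
    unfolding v_def cmat_mult_vec_Re_Im(2)[OF A w(1), symmetric] eig
    by (rule eq_vecI) (use w in \<open>auto simp: u_def\<close>)
  have "Re z * (u \<bullet> u + v \<bullet> v) = u \<bullet> (A *\<^sub>v u) + v \<bullet> (A *\<^sub>v v)"
    using u v comm_scalar_prod[OF u v]
    by (simp add: Au Av scalar_prod_minus_distrib[of _ n] scalar_prod_add_distrib[of _ n]
        algebra_simps)
  also have "\<dots> \<le> 0"
    using nonpos[OF u] nonpos[OF v] by simp
  finally have "Re z * (u \<bullet> u + v \<bullet> v) \<le> 0" .
  moreover have "u \<bullet> u + v \<bullet> v > 0"
    unfolding u_def v_def using w by (rule scalar_prod_Re_Im_pos)
  ultimately show "Re z \<le> 0"
    by (simp add: mult_le_0_iff)
qed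

lemma skew_quadratic_form_zero:
  fixes R :: "'a :: linordered_idom mat"
  assumes R: "R \<in> carrier_mat n n" and skew: "transpose_mat R = - R" and x: "x \<in> carrier_vec n"
  shows "x \<bullet> (R *\<^sub>v x) = 0"
proof -
  have "x \<bullet> (R *\<^sub>v x) = (- R *\<^sub>v x) \<bullet> x"
    using transpose_vec_mult_scalar[OF R x x] by (simp add: skew)
  also have "\<dots> = - (x \<bullet> (R *\<^sub>v x))"
    using R x by (simp add: comm_scalar_prod[of "R *\<^sub>v x" n])
  finally show ?thesis
    by simp
qed

lemma diagonal_quadratic_form:
  fixes E :: "'a :: comm_semiring_1 mat"
  assumes E: "E \<in> carrier_mat n n" and off: "\<And>i j. i < n \<Longrightarrow> j < n \<Longrightarrow> i \<noteq> j \<Longrightarrow> E $$ (i,j) = 0"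
    and x: "x \<in> carrier_vec n"
  shows "x \<bullet> (E *\<^sub>v x) = (\<Sum>i<n. E $$ (i,i) * (x $ i)\<^sup>2)"
proof -
  have "(E *\<^sub>v x) $ i = E $$ (i,i) * x $ i" if "i < n" for i
  proof -
    have "(E *\<^sub>v x) $ i = (\<Sum>j<n. E $$ (i,j) * x $ j)"
      using E x that by (simp add: scalar_prod_def atLeast0LessThan)
    also have "\<dots> = (\<Sum>j<n. if j = i then E $$ (i,i) * x $ i else 0)"
      using off that by (intro sum.cong) auto
    finally show ?thesis
      using that by simp
  qed
  then show ?thesis
    using E x by (simp add: scalar_prod_def atLeast0LessThan power2_eq_square mult_ac)
qed

lemma skew_minus_projection_imp_spectrally_stable:
  assumes "skew_minus_projection n P"
  shows "spectrally_stable (cmat P)"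
proof -
  obtain R E where R: "R \<in> carrier_mat n n" "transpose_mat R = - R"
    and E: "E \<in> carrier_mat n n" "\<And>i j. i < n \<Longrightarrow> j < n \<Longrightarrow> i \<noteq> j \<Longrightarrow> E $$ (i,j) = 0"
    and diag: "\<And>i. i < n \<Longrightarrow> E $$ (i,i) \<in> {0, 1}" and P: "P = R - E"
    using assms unfolding skew_minus_projection_def by blast
  show ?thesis
  proof (rule spectrally_stable_if_quadratic_form_nonpos)
    show "P \<in> carrier_mat n n"
      using minus_carrier_mat[OF E(1)] by (simp add: P)
    fix x :: "real vec" assume x: "x \<in> carrier_vec n"
    have "x \<bullet> (E *\<^sub>v x) = (\<Sum>i<n. E $$ (i,i) * (x $ i)\<^sup>2)"
      by (rule diagonal_quadratic_form[OF E x])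
    also have "\<dots> \<ge> 0"
      using diag by (intro sum_nonneg) fastforce
    finally have "x \<bullet> (E *\<^sub>v x) \<ge> 0" .
    moreover have "x \<bullet> (P *\<^sub>v x) = x \<bullet> (R *\<^sub>v x) - x \<bullet> (E *\<^sub>v x)"
      using R E x
      by (simp add: P minus_mult_distrib_mat_vec[of _ n n] scalar_prod_minus_distrib[of _ n])
    ultimately show "x \<bullet> (P *\<^sub>v x) \<le> 0"
      using skew_quadratic_form_zero[OF R x] by simp
  qed
qed

lemma skew_minus_projectionI:
  assumes P: "P \<in> carrier_mat n n"
    and diag: "\<And>i. i < n \<Longrightarrow> P $$ (i,i) \<in> {-1, 0}"
    and off: "\<And>i j. i < n \<Longrightarrow> j < n \<Longrightarrow> i \<noteq> j \<Longrightarrow> P $$ (j,i) = - P $$ (i,j)"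
  shows "skew_minus_projection n P"
proof -
  define R where "R = mat n n (\<lambda>(i,j). if i = j then 0 else P $$ (i,j))"
  define E where "E = mat n n (\<lambda>(i,j). if i = j then - P $$ (i,i) else 0)"
  have "R \<in> carrier_mat n n" "E \<in> carrier_mat n n"
    by (simp_all add: R_def E_def)
  moreover have "transpose_mat R = - R"
    by (rule eq_matI) (auto simp: R_def intro: off)
  moreover have "P = R - E"
    by (rule eq_matI) (use P in \<open>auto simp: R_def E_def\<close>)
  moreover have "\<forall>i<n. \<forall>j<n. i \<noteq> j \<longrightarrow> E $$ (i,j) = 0"
    by (simp add: E_def)
  moreover have "\<forall>i<n. E $$ (i,i) \<in> {0, 1}"
    using diag by (force simp: E_def)
  ultimately show ?thesis
    unfolding skew_minus_projection_def by blast
qed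

section \<open>Signed permutation matrices\<close>

lemma mult_mat_vec_geometric_sum:
  fixes A :: "'a :: comm_ring_1 mat"
  assumes A: "A \<in> carrier_mat n n" and v: "v \<in> carrier_vec n"
    and period: "(mult_mat_vec A ^^ l) v = x ^ l \<cdot>\<^sub>v v"
  defines "w \<equiv> vec n (\<lambda>i. \<Sum>k<l. x ^ (l - Suc k) * (mult_mat_vec A ^^ k) v $ i)"
  shows "A *\<^sub>v w = x \<cdot>\<^sub>v w"
proof (rule eq_vecI)
  have iterate: "(mult_mat_vec A ^^ k) v \<in> carrier_vec n" for k
    by (induction k) (use A v in auto)
  fix i assume "i < dim_vec (x \<cdot>\<^sub>v w)"
  then have i: "i < n"
    by (simp add: w_def)
  define g where "g k = x ^ (l - k) * (mult_mat_vec A ^^ k) v $ i" for k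
  have "(A *\<^sub>v w) $ i = (\<Sum>j<n. \<Sum>k<l. x ^ (l - Suc k) * (A $$ (i,j) * (mult_mat_vec A ^^ k) v $ j))"
    using A i by (simp add: w_def scalar_prod_def atLeast0LessThan sum_distrib_left mult_ac)
  also have "\<dots> = (\<Sum>k<l. x ^ (l - Suc k) * (\<Sum>j<n. A $$ (i,j) * (mult_mat_vec A ^^ k) v $ j))"
    by (subst sum.swap) (simp add: sum_distrib_left)
  also have "\<dots> = (\<Sum>k<l. g (Suc k))"
    using A i carrier_vecD[OF iterate] by (simp add: g_def scalar_prod_def atLeast0LessThan)
  also have "\<dots> = (\<Sum>k<l. g k)"
  proof -
    have "g l = g 0"
      using v i by (simp add: g_def period)
    then show ?thesis
      using sum.lessThan_Suc_shift[of g l] by simp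
  qed
  also have "\<dots> = x * w $ i"
    using i by (simp add: g_def w_def sum_distrib_left Suc_diff_Suc flip: mult.assoc power_Suc)
  also have "\<dots> = (x \<cdot>\<^sub>v w) $ i"
    using i by (simp add: w_def)
  finally show "(A *\<^sub>v w) $ i = (x \<cdot>\<^sub>v w) $ i" .
qed (use A in \<open>simp add: w_def\<close>)

lemma monomial_funpow_unit_vec:
  fixes A :: "'a :: field mat"
  assumes A: "A \<in> carrier_mat n n" and \<sigma>: "\<sigma> permutes {..<n}"
    and monomial: "\<And>j. j < n \<Longrightarrow> A *\<^sub>v unit_vec n j = c j \<cdot>\<^sub>v unit_vec n (\<sigma> j)" and "a < n"
  shows "(mult_mat_vec A ^^ k) (unit_vec n a)
    = (\<Prod>t<k. c ((\<sigma> ^^ t) a)) \<cdot>\<^sub>v unit_vec n ((\<sigma> ^^ k) a)"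
proof (induction k)
  case (Suc k)
  have "(\<sigma> ^^ k) a < n"
    using permutes_in_image[OF permutes_funpow[OF \<sigma>], of k a] \<open>a < n\<close> by simp
  then show ?case
    using Suc A by (simp add: mult_mat_vec[of A n n] monomial smult_smult_assoc)
qed (simp add: \<open>a < n\<close>)

lemma eigenvalue_monomial_cycle:
  fixes A :: "'a :: field mat"
  assumes A: "A \<in> carrier_mat n n" and \<sigma>: "\<sigma> permutes {..<n}"
    and monomial: "\<And>j. j < n \<Longrightarrow> A *\<^sub>v unit_vec n j = c j \<cdot>\<^sub>v unit_vec n (\<sigma> j)" and a: "a < n"
    and root: "x ^ least_power \<sigma> a = (\<Prod>t<least_power \<sigma> a. c ((\<sigma> ^^ t) a))" and "x \<noteq> 0"
  shows "eigenvalue A x"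
proof -
  define l where "l = least_power \<sigma> a"
  have "permutation \<sigma>"
    using finite_lessThan \<sigma> by (rule permutes_imp_permutation)
  then have l: "(\<sigma> ^^ l) a = a" "l > 0"
    unfolding l_def by (rule least_power_of_permutation)+
  have minimal: "a = (\<sigma> ^^ k) a \<longleftrightarrow> k = 0" if "k < l" for k
    using least_power_le[of k \<sigma> a] that by (fastforce simp: l_def)
  have orbit: "(\<sigma> ^^ k) a < n" for k
    using permutes_in_image[OF permutes_funpow[OF \<sigma>], of k a] a by simp
  have iterate: "(mult_mat_vec A ^^ k) (unit_vec n a)
      = (\<Prod>t<k. c ((\<sigma> ^^ t) a)) \<cdot>\<^sub>v unit_vec n ((\<sigma> ^^ k) a)" for k
    by (rule monomial_funpow_unit_vec[OF A \<sigma> monomial a])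
  define w where "w = vec n (\<lambda>i. \<Sum>k<l. x ^ (l - Suc k) * (mult_mat_vec A ^^ k) (unit_vec n a) $ i)"
  have "w \<in> carrier_vec n"
    by (simp add: w_def)
  moreover have "A *\<^sub>v w = x \<cdot>\<^sub>v w"
    unfolding w_def
    by (rule mult_mat_vec_geometric_sum[OF A]) (use l root in \<open>simp_all add: iterate flip: l_def\<close>)
  moreover have "w $ a = x ^ (l - 1)"
  proof -
    have "w $ a = (\<Sum>k<l. x ^ (l - Suc k) * (mult_mat_vec A ^^ k) (unit_vec n a) $ a)"
      using a by (simp add: w_def)
    also have "\<dots> = (\<Sum>k<l. if k = 0 then x ^ (l - 1) else 0)"
      by (rule sum.cong) (use a orbit in \<open>auto simp: iterate minimal\<close>)
    finally show ?thesis
      using l by simp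
  qed
  then have "w \<noteq> 0\<^sub>v n"
    using a \<open>x \<noteq> 0\<close> by auto
  ultimately show ?thesis
    unfolding eigenvalue_def eigenvector_def using A by auto
qed

lemma roots_of_sign_Re_nonpos_imp:
  fixes s :: real
  assumes "s \<in> {-1, 1}" and "l > 0"
    and left: "\<And>x::complex. x ^ l = of_real s \<Longrightarrow> Re x \<le> 0"
  shows "s = -1" and "l \<le> 2"
proof -
  show s: "s = -1"
    using assms(1) left[of 1] by auto
  show "l \<le> 2"
  proof (rule ccontr)
    assume "\<not> l \<le> 2"
    then have "pi / real l < pi / 2" and "0 < pi / real l"
      by (simp_all add: field_simps)
    then have "cos (pi / real l) > 0"
      by (intro cos_gt_zero_pi) auto
    moreover have "cis (pi / real l) ^ l = of_real s"
      using \<open>l > 0\<close> s by (simp add: DeMoivre)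
    then have "Re (cis (pi / real l)) \<le> 0"
      by (rule left)
    ultimately show False
      by simp
  qed
qed

lemma signed_perm_mat_obtain_permutation:
  assumes P: "signed_perm_mat n P"
  obtains \<sigma> where "\<sigma> permutes {..<n}"
    and "\<And>j. j < n \<Longrightarrow> P $$ (\<sigma> j, j) \<in> {-1, 1}"
    and "\<And>i j. i < n \<Longrightarrow> j < n \<Longrightarrow> i \<noteq> \<sigma> j \<Longrightarrow> P $$ (i,j) = 0"
proof -
  define \<sigma> where "\<sigma> j = (if j < n then THE i. i < n \<and> P $$ (i,j) \<noteq> 0 else j)" for j
  have row: "\<exists>!j. j < n \<and> P $$ (i,j) \<noteq> 0" if "i < n" for i
    using P that by (auto simp: signed_perm_mat_def)
  have col: "\<exists>!i. i < n \<and> P $$ (i,j) \<noteq> 0" if "j < n" for j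
    using P that by (auto simp: signed_perm_mat_def)
  have \<sigma>: "\<sigma> j < n \<and> P $$ (\<sigma> j, j) \<noteq> 0" if "j < n" for j
    using theI'[OF col[OF that]] that by (simp add: \<sigma>_def)
  have "inj_on \<sigma> {..<n}"
    using \<sigma> row by (intro inj_onI) (metis lessThan_iff)
  moreover have "\<sigma> ` {..<n} \<subseteq> {..<n}"
    using \<sigma> by auto
  ultimately have "bij_betw \<sigma> {..<n} {..<n}"
    by (simp add: bij_betw_def endo_inj_surj)
  then have "\<sigma> permutes {..<n}"
    by (rule bij_imp_permutes) (simp add: \<sigma>_def)
  moreover have "P $$ (\<sigma> j, j) \<in> {-1, 1}" if "j < n" for j
    using P \<sigma>[OF that] that by (auto simp: signed_perm_mat_def)
  moreover have "P $$ (i,j) = 0" if "i < n" "j < n" "i \<noteq> \<sigma> j" for i j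
    using \<sigma> col that by blast
  ultimately show thesis
    by (rule that)
qed

lemma spectrally_stable_signed_cycle:
  assumes stable: "spectrally_stable A" and A: "A \<in> carrier_mat n n"
    and \<sigma>: "\<sigma> permutes {..<n}"
    and monomial: "\<And>j. j < n \<Longrightarrow> A *\<^sub>v unit_vec n j = of_real (s j) \<cdot>\<^sub>v unit_vec n (\<sigma> j)"
    and sign: "\<And>j. j < n \<Longrightarrow> s j \<in> {-1, 1}" and a: "a < n"
  shows "(\<sigma> a = a \<and> s a = -1) \<or> (\<sigma> (\<sigma> a) = a \<and> s a * s (\<sigma> a) = -1)"
proof -
  define l where "l = least_power \<sigma> a"
  define \<epsilon> where "\<epsilon> = (\<Prod>t<l. s ((\<sigma> ^^ t) a))"
  have "permutation \<sigma>"
    using finite_lessThan \<sigma> by (rule permutes_imp_permutation)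
  then have l: "(\<sigma> ^^ l) a = a" "l > 0"
    unfolding l_def by (rule least_power_of_permutation)+
  have "s ((\<sigma> ^^ t) a) \<in> {-1, 1}" for t
    using permutes_in_image[OF permutes_funpow[OF \<sigma>], of t a] a by (intro sign) simp
  then have "\<bar>\<epsilon>\<bar> = 1"
    unfolding \<epsilon>_def abs_prod by (intro prod.neutral) (force simp: abs_if)
  then have \<epsilon>: "\<epsilon> \<in> {-1, 1}"
    by (auto simp: abs_if split: if_splits)
  have "Re x \<le> 0" if root: "x ^ l = of_real \<epsilon>" for x :: complex
  proof -
    have "x \<noteq> 0"
      using root \<epsilon> l by (auto simp: power_0_left)
    then have "eigenvalue A x"
      using eigenvalue_monomial_cycle[OF A \<sigma> monomial a, of x] root
      by (simp add: \<epsilon>_def flip: l_def)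
    then show ?thesis
      using stable by (simp add: spectrally_stable_def)
  qed
  then have "\<epsilon> = -1" "l \<le> 2"
    using roots_of_sign_Re_nonpos_imp[OF \<epsilon> l(2)] by blast+
  then consider "l = 1" | "l = 2"
    using l by linarith
  then show ?thesis
    by cases (use l \<open>\<epsilon> = -1\<close> in \<open>auto simp: \<epsilon>_def numeral_2_eq_2\<close>)
qed

lemma mult_unit_vec_if_column_support:
  fixes A :: "'a :: semiring_1 mat"
  assumes A: "A \<in> carrier_mat nr nc" and "k < nr" and "j < nc"
    and support: "\<And>i. i < nr \<Longrightarrow> i \<noteq> k \<Longrightarrow> A $$ (i,j) = 0"
  shows "A *\<^sub>v unit_vec nc j = A $$ (k,j) \<cdot>\<^sub>v unit_vec nr k"
proof (rule eq_vecI)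
  fix i assume "i < dim_vec (A $$ (k,j) \<cdot>\<^sub>v unit_vec nr k)"
  then show "(A *\<^sub>v unit_vec nc j) $ i = (A $$ (k,j) \<cdot>\<^sub>v unit_vec nr k) $ i"
    using A \<open>k < nr\<close> \<open>j < nc\<close> support[of i] by auto
qed (use A in simp)

lemma spectrally_stable_signed_perm_mat_iff:
  assumes P: "signed_perm_mat n P"
  shows "spectrally_stable (cmat P) \<longleftrightarrow> skew_minus_projection n P"
proof
  assume stable: "spectrally_stable (cmat P)"
  have carrier: "P \<in> carrier_mat n n"
    using P by (simp add: signed_perm_mat_def)
  obtain \<sigma> where \<sigma>: "\<sigma> permutes {..<n}" and sign: "\<And>j. j < n \<Longrightarrow> P $$ (\<sigma> j, j) \<in> {-1, 1}"
    and zero: "\<And>i j. i < n \<Longrightarrow> j < n \<Longrightarrow> i \<noteq> \<sigma> j \<Longrightarrow> P $$ (i,j) = 0"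
    using signed_perm_mat_obtain_permutation[OF P] by blast
  have "cmat P *\<^sub>v unit_vec n j = of_real (P $$ (\<sigma> j, j)) \<cdot>\<^sub>v unit_vec n (\<sigma> j)" if "j < n" for j
    using mult_unit_vec_if_column_support[of "cmat P" n n "\<sigma> j" j]
      carrier zero permutes_in_image[OF \<sigma>, of j] that
    by (simp add: cmat_def)
  with sign have cycle: "(\<sigma> a = a \<and> P $$ (\<sigma> a, a) = -1)
      \<or> (\<sigma> (\<sigma> a) = a \<and> P $$ (\<sigma> a, a) * P $$ (\<sigma> (\<sigma> a), \<sigma> a) = -1)" if "a < n" for a
    using spectrally_stable_signed_cycle[OF stable, of n \<sigma> "\<lambda>j. P $$ (\<sigma> j, j)"] carrier \<sigma> that
    by simp
  have transposed: "P $$ (j,i) = - P $$ (i,j)"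
    if "i < n" "j < n" "i \<noteq> j" "P $$ (i,j) \<noteq> 0" for i j
  proof -
    have "i = \<sigma> j"
      using zero that by blast
    then have "\<sigma> i = j" and "P $$ (i,j) * P $$ (j,i) = -1"
      using cycle[OF \<open>j < n\<close>] \<open>i \<noteq> j\<close> by auto
    then show ?thesis
      using sign[OF \<open>j < n\<close>] \<open>i = \<sigma> j\<close> by auto
  qed
  show "skew_minus_projection n P"
  proof (rule skew_minus_projectionI[OF carrier])
    show "P $$ (i,i) \<in> {-1, 0}" if "i < n" for i
      using cycle[OF that] sign[OF that] zero[OF that that] by (cases "\<sigma> i = i") auto
    show "P $$ (j,i) = - P $$ (i,j)" if "i < n" "j < n" "i \<noteq> j" for i j
      using transposed[of i j] transposed[of j i] that by fastforce
  qed
qed (rule skew_minus_projection_imp_spectrally_stable)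

section \<open>Stability at wavenumber zero\<close>

lemma dispersion_relation_zero_iff:
  fixes n :: nat and \<tau> :: real and \<omega> :: complex
  assumes P: "P \<in> carrier_mat n n"
  shows "det (- (\<i> * \<omega>) \<cdot>\<^sub>m cmat (D_mat (Suc n) \<tau>) - cmat (B_hat (Suc n) \<alpha> P)) = 0 \<longleftrightarrow>
    \<i> * \<omega> = of_real (\<alpha> 0) \<or> eigenvalue (cmat P) (- (\<i> * \<omega> * of_real \<tau>))"
proof -
  let ?x = "- (\<i> * \<omega> * of_real \<tau>)"
  let ?S = "mat 1 1 (\<lambda>_. of_real (\<alpha> 0) - \<i> * \<omega>)"
  let ?C = "- char_matrix (cmat P) ?x"
  have C: "?C \<in> carrier_mat n n"
    using P by simp
  have "- (\<i> * \<omega>) \<cdot>\<^sub>m cmat (D_mat (Suc n) \<tau>) - cmat (B_hat (Suc n) \<alpha> P)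
      = four_block_mat ?S (0\<^sub>m 1 n) (0\<^sub>m n 1) ?C"
    by (rule eq_matI)
      (use P in \<open>auto simp: cmat_def D_mat_def B_hat_def char_matrix_def less_Suc_eq_0_disj\<close>)
  also have "det \<dots> = det ?S * det ?C"
    by (rule det_four_block_mat_lower_left_zero) (use C in auto)
  also have "\<dots> = (of_real (\<alpha> 0) - \<i> * \<omega>) * poly (char_poly (cmat P)) ?x"
    using P by (simp add: det_single char_poly_matrix[of _ n])
  finally show ?thesis
    using P by (auto simp: eigenvalue_root_char_poly[of _ n])
qed

lemma stable_at_zero_iff_spectrally_stable:
  fixes n :: nat and \<tau> :: real
  assumes P: "P \<in> carrier_mat n n" and "\<tau> > 0" and "\<alpha> 0 \<ge> 0"
  shows "(\<forall>\<omega>. det (- (\<i> * \<omega>) \<cdot>\<^sub>m cmat (D_mat (Suc n) \<tau>) - cmat (B_hat (Suc n) \<alpha> P)) = 0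
      \<longrightarrow> Im \<omega> \<le> 0) \<longleftrightarrow> spectrally_stable (cmat P)"
    (is "?stable \<longleftrightarrow> _")
proof
  assume stable: ?stable
  show "spectrally_stable (cmat P)"
    unfolding spectrally_stable_def
  proof (intro allI impI)
    fix x assume "eigenvalue (cmat P) x"
    then have "Im (\<i> * x / of_real \<tau>) \<le> 0"
      using stable[unfolded dispersion_relation_zero_iff[OF P], rule_format,
          of "\<i> * x / of_real \<tau>"] \<open>\<tau> > 0\<close> by simp
    then show "Re x \<le> 0"
      using \<open>\<tau> > 0\<close> by (simp add: divide_le_0_iff)
  qed
next
  assume stable: "spectrally_stable (cmat P)"
  show ?stable
    unfolding dispersion_relation_zero_iff[OF P]
  proof (intro allI impI, elim disjE)
    fix \<omega> :: complex
    assume "\<i> * \<omega> = of_real (\<alpha> 0)"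
    then have "- Im \<omega> = \<alpha> 0"
      by (metis Re_complex_of_real Re_i_times)
    then show "Im \<omega> \<le> 0"
      using \<open>\<alpha> 0 \<ge> 0\<close> by simp
  next
    fix \<omega> :: complex
    assume "eigenvalue (cmat P) (- (\<i> * \<omega> * of_real \<tau>))"
    then have "Re (- (\<i> * \<omega> * of_real \<tau>)) \<le> 0"
      using stable by (simp only: spectrally_stable_def)
    then show "Im \<omega> \<le> 0"
      using \<open>\<tau> > 0\<close> by (simp add: mult_le_0_iff)
  qed
qed

section \<open>Stability for large wavenumbers\<close>

lemma quadratic_root_real:
  fixes z :: complex and b c :: real
  assumes z: "z\<^sup>2 = of_real b * z + of_real c" and "b\<^sup>2 + 4 * c \<ge> 0"
  shows "z \<in> \<real>"
proof -
  define d where "d = sqrt (b\<^sup>2 + 4 * c)"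
  have "(2 * z - of_real b)\<^sup>2 = 4 * z\<^sup>2 - 4 * of_real b * z + of_real (b\<^sup>2)"
    by (simp add: power2_eq_square algebra_simps)
  also have "\<dots> = of_real (d\<^sup>2)"
    using assms by (simp add: d_def)
  finally have "2 * z - of_real b = of_real d \<or> 2 * z - of_real b = - of_real d"
    by (simp add: power2_eq_iff)
  then have "z = of_real ((b + d) / 2) \<or> z = of_real ((b - d) / 2)"
    by (auto simp: field_simps)
  then show ?thesis
    by (metis Reals_of_real)
qed

definition antidiagonal_plus_row :: "nat \<Rightarrow> (nat \<Rightarrow> 'a) \<Rightarrow> (nat \<Rightarrow> 'a) \<Rightarrow> 'a :: zero mat" where
  "antidiagonal_plus_row m s b =
    mat m m (\<lambda>(i,j). if i + j = m - 1 then s i else if i = 0 then b j else 0)"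

lemma antidiagonal_plus_row_mult_vec:
  fixes s b :: "nat \<Rightarrow> 'a :: semiring_0"
  assumes "v \<in> carrier_vec m" and "i < m"
  shows "(antidiagonal_plus_row m s b *\<^sub>v v) $ i =
    s i * v $ (m - 1 - i) + (if i = 0 then \<Sum>j<m - 1. b j * v $ j else 0)"
proof -
  let ?row = "\<lambda>j. (if i + j = m - 1 then s i else if i = 0 then b j else 0) * v $ j"
  have "(antidiagonal_plus_row m s b *\<^sub>v v) $ i = (\<Sum>j<m. ?row j)"
    using assms by (simp add: antidiagonal_plus_row_def scalar_prod_def atLeast0LessThan)
  also have "\<dots> = ?row (m - 1 - i) + (\<Sum>j\<in>{..<m} - {m - 1 - i}. ?row j)"
    using \<open>i < m\<close> by (intro sum.remove) auto
  also have "(\<Sum>j\<in>{..<m} - {m - 1 - i}. ?row j) = (if i = 0 then \<Sum>j<m - 1. b j * v $ j else 0)"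
  proof (cases "i = 0")
    case True
    have "{..<m} - {m - 1} = {..<m - 1}"
      by auto
    with True show ?thesis
      by (auto intro!: sum.cong)
  next
    case False
    then show ?thesis
      by (auto intro!: sum.neutral split: if_splits)
  qed
  finally show ?thesis
    using \<open>i < m\<close> by simp
qed

lemma eigen_equation_two_components:
  fixes z :: "'a :: field"
  assumes first: "c * y + b * x = z * x" and last: "d * x = z * y"
    and "c * d = 1" and "x \<noteq> 0 \<or> y \<noteq> 0"
  shows "z\<^sup>2 = b * z + 1"
proof -
  have "x \<noteq> 0"
    using assms by auto
  have "z\<^sup>2 * x = z * (c * y + b * x)"
    by (simp add: first power2_eq_square)
  also have "\<dots> = c * (z * y) + b * z * x"
    by (simp add: algebra_simps)
  also have "\<dots> = (b * z + c * d) * x"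
    unfolding last[symmetric] by (simp add: algebra_simps)
  finally show ?thesis
    using \<open>x \<noteq> 0\<close> \<open>c * d = 1\<close> by simp
qed

lemma eigenvector_antidiagonal_plus_row:
  fixes z :: "'a :: field"
  assumes "eigenvector (antidiagonal_plus_row m s b) v z" and "i < m"
  shows "s i * v $ (m - 1 - i) + (if i = 0 then \<Sum>j<m - 1. b j * v $ j else 0) = z * v $ i"
proof -
  have v: "v \<in> carrier_vec m" and eig: "antidiagonal_plus_row m s b *\<^sub>v v = z \<cdot>\<^sub>v v"
    using assms(1) by (auto simp: eigenvector_def antidiagonal_plus_row_def)
  show ?thesis
    using arg_cong[OF eig, of "\<lambda>u. u $ i"] antidiagonal_plus_row_mult_vec[OF v \<open>i < m\<close>] v \<open>i < m\<close>
    by simp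
qed

lemma eigenvector_antidiagonal_plus_row_inner:
  fixes z :: "'a :: field"
  assumes eig: "eigenvector (antidiagonal_plus_row m s b) v z"
    and i: "0 < i" "i < m - 1" "v $ i \<noteq> 0" and involutive: "s i * s (m - 1 - i) = 1"
  shows "z\<^sup>2 = 1"
proof -
  have "z\<^sup>2 * v $ i = s i * (z * v $ (m - 1 - i))"
    using eigenvector_antidiagonal_plus_row[OF eig, of i] i by (simp add: power2_eq_square mult_ac)
  also have "\<dots> = (s i * s (m - 1 - i)) * v $ i"
    using eigenvector_antidiagonal_plus_row[OF eig, of "m - 1 - i"] i by (auto split: if_splits)
  finally show ?thesis
    using \<open>v $ i \<noteq> 0\<close> involutive by simp
qed

lemma eigenvector_antidiagonal_plus_row_outer:
  fixes z :: "'a :: field"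
  assumes "m \<ge> 2" and eig: "eigenvector (antidiagonal_plus_row m s b) v z"
    and inner: "\<And>i. 0 < i \<Longrightarrow> i < m - 1 \<Longrightarrow> v $ i = 0" and involutive: "s 0 * s (m - 1) = 1"
  shows "z\<^sup>2 = b 0 * z + 1"
proof -
  have v: "v \<in> carrier_vec m" "v \<noteq> 0\<^sub>v m"
    using eig by (auto simp: eigenvector_def antidiagonal_plus_row_def)
  have "(\<Sum>j<m - 1. b j * v $ j) = (\<Sum>j\<in>{0}. b j * v $ j)"
    using \<open>m \<ge> 2\<close> inner by (intro sum.mono_neutral_right) auto
  then have first: "s 0 * v $ (m - 1) + b 0 * v $ 0 = z * v $ 0"
    using eigenvector_antidiagonal_plus_row[OF eig, of 0] \<open>m \<ge> 2\<close> by simp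
  have last: "s (m - 1) * v $ 0 = z * v $ (m - 1)"
    using eigenvector_antidiagonal_plus_row[OF eig, of "m - 1"] \<open>m \<ge> 2\<close> by simp
  have "v $ 0 \<noteq> 0 \<or> v $ (m - 1) \<noteq> 0"
  proof (rule ccontr)
    assume "\<not> (v $ 0 \<noteq> 0 \<or> v $ (m - 1) \<noteq> 0)"
    with inner have "v $ i = 0" if "i < m" for i
      using that by (cases "i = m - 1"; cases "i = 0") auto
    with v show False
      by (auto simp: vec_eq_iff)
  qed
  with first last involutive show ?thesis
    by (rule eigen_equation_two_components)
qed

lemma eigenvalue_antidiagonal_plus_row:
  fixes z :: "'a :: field"
  assumes "m \<ge> 2" and "eigenvalue (antidiagonal_plus_row m s b) z"
    and involutive: "\<And>i. i < m \<Longrightarrow> s i * s (m - 1 - i) = 1"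
  shows "z\<^sup>2 = 1 \<or> z\<^sup>2 = b 0 * z + 1"
proof -
  obtain v where eig: "eigenvector (antidiagonal_plus_row m s b) v z"
    using assms(2) by (auto simp: eigenvalue_def)
  show ?thesis
  proof (cases "\<exists>i. 0 < i \<and> i < m - 1 \<and> v $ i \<noteq> 0")
    case True
    then obtain i where "0 < i" "i < m - 1" "v $ i \<noteq> 0"
      by blast
    with involutive[of i] have "z\<^sup>2 = 1"
      by (intro eigenvector_antidiagonal_plus_row_inner[OF eig]) auto
    then show ?thesis ..
  next
    case False
    with involutive[of 0] \<open>m \<ge> 2\<close> have "z\<^sup>2 = b 0 * z + 1"
      by (intro eigenvector_antidiagonal_plus_row_outer[OF _ eig]) auto
    then show ?thesis ..
  qed
qed

lemma A_hat_P_star: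
  "A_hat m \<sigma>0 a (P_star m \<sigma>0) =
    antidiagonal_plus_row m (\<lambda>i. \<sigma>0 * (-1) ^ min i (m - 1 - i)) (\<lambda>j. a (j + 1))"
    (is "_ = ?M")
proof (rule eq_matI)
  fix i j assume "i < dim_row ?M" and "j < dim_col ?M"
  then have "i < m" "j < m"
    by (simp_all add: antidiagonal_plus_row_def)
  moreover from this have "m - Suc j = i" "m - Suc i = j" if "i + j = m - 1"
    using that by auto
  ultimately show "A_hat m \<sigma>0 a (P_star m \<sigma>0) $$ (i,j) = ?M $$ (i,j)"
    by (cases "i = 0") (auto simp: A_hat_def P_star_def antidiagonal_plus_row_def Let_def min_def)
qed (simp_all add: A_hat_def antidiagonal_plus_row_def)

lemma eigenvalue_A_hat_P_star_real:
  fixes z :: complex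
  assumes "m \<ge> 2" and \<sigma>0: "\<sigma>0 \<in> {-1, 1}"
    and eig: "eigenvalue (cmat (A_hat m \<sigma>0 a (P_star m \<sigma>0))) z"
  shows "z \<in> \<real>"
proof -
  define s where "s i = complex_of_real (\<sigma>0 * (-1) ^ min i (m - 1 - i))" for i
  have "cmat (A_hat m \<sigma>0 a (P_star m \<sigma>0)) =
      antidiagonal_plus_row m s (\<lambda>j. of_real (a (j + 1)))"
    by (rule eq_matI) (simp_all add: A_hat_P_star antidiagonal_plus_row_def cmat_def s_def)
  moreover have "s i * s (m - 1 - i) = 1" if "i < m" for i
    using \<sigma>0 that by (auto simp: s_def min.commute simp flip: power_add power_mult_distrib)
  ultimately have "z\<^sup>2 = 1 \<or> z\<^sup>2 = of_real (a 1) * z + 1"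
    using eigenvalue_antidiagonal_plus_row[OF \<open>m \<ge> 2\<close>, of s "\<lambda>j. of_real (a (j + 1))" z] eig
    by simp
  then show ?thesis
    using quadratic_root_real[of z 0 1] quadratic_root_real[of z "a 1" 1] by auto
qed

theorem theorem2:
  fixes m :: nat and \<sigma>0 \<tau> :: real and \<alpha> :: "nat \<Rightarrow> real" and P :: "real mat"
  assumes "m \<ge> 2" and "\<sigma>0 \<in> {-1, 1}" and "\<tau> > 0" and "\<alpha> 0 \<ge> 0"
    and "signed_perm_mat (m - 1) P"
  shows "((\<forall>\<omega>::complex.
             det (- (\<i> * \<omega>) \<cdot>\<^sub>m cmat (D_mat m \<tau>) - cmat (B_hat m \<alpha> P)) = 0
             \<longrightarrow> Im \<omega> \<le> 0)
          \<longleftrightarrow> (\<exists>R E. R \<in> carrier_mat (m-1) (m-1) \<and> E \<in> carrier_mat (m-1) (m-1)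
                  \<and> transpose_mat R = - R
                  \<and> (\<forall>i<m-1. \<forall>j<m-1. i \<noteq> j \<longrightarrow> E $$ (i,j) = 0)
                  \<and> (\<forall>i<m-1. E $$ (i,i) \<in> {0, 1})
                  \<and> P = R - E))
       \<and> (P = P_star m \<sigma>0 \<longrightarrow>
           (\<forall>a :: nat \<Rightarrow> real. \<forall>z::complex.
              eigenvalue (cmat (A_hat m \<sigma>0 a P)) z \<longrightarrow> z \<in> \<real>))"
    (is "(?stable \<longleftrightarrow> ?decomposition) \<and> ?real_spectrum")
proof
  have m: "m = Suc (m - 1)"
    using \<open>m \<ge> 2\<close> by simp
  have P: "P \<in> carrier_mat (m - 1) (m - 1)"
    using \<open>signed_perm_mat (m - 1) P\<close> by (simp add: signed_perm_mat_def)
  have "?stable \<longleftrightarrow> spectrally_stable (cmat P)"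
    using stable_at_zero_iff_spectrally_stable[where \<alpha> = \<alpha>, OF P \<open>\<tau> > 0\<close> \<open>\<alpha> 0 \<ge> 0\<close>]
    by (simp only: flip: m)
  also have "\<dots> \<longleftrightarrow> skew_minus_projection (m - 1) P"
    using \<open>signed_perm_mat (m - 1) P\<close> by (rule spectrally_stable_signed_perm_mat_iff)
  finally show "?stable \<longleftrightarrow> ?decomposition"
    by (simp only: skew_minus_projection_def)
  show ?real_spectrum
    using eigenvalue_A_hat_P_star_real[OF \<open>m \<ge> 2\<close> \<open>\<sigma>0 \<in> {-1, 1}\<close>] by blast
qed

end
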